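(* For every integer $N\ge1$, let $p_N(a,b\mid x,y)$, $x,y\in\{0,1\}$, $a,b\in\{0,1\}^N$, be the quantum correlation $p_N(a,b\mid x,y)=\prod_{i=1}^N\langle\phi|A_{a_i|x}\otimes B_{b_i|y}|\phi\rangle$, obtained by measuring $N$ copies of the two-qubit state $$|\phi\rangle=s(|01\rangle+|10\rangle)+\sqrt{1-2s^2}\,|11\rangle,\qquad s=\tfrac{\sqrt5-1}{2},$$ with projectors $A_{0|1}=B_{0|1}=|0\rangle\langle0|$, $A_{0|0}=B_{0|0}=|\varphi\rangle\langle\varphi|$, $|\varphi\rangle=\frac{1}{\sqrt{1-s^2}}(\sqrt{1-2s^2}\,|0\rangle-s|1\rangle)$, and $A_{1|x}=\mathbb 1-A_{0|x}$, $B_{1|y}=\mathbb 1-B_{0|y}$. Say that a correlation $p$ satisfies (Z) if $p(a,b\mid0,1)=0$ whenever $(a_i,b_i)=(0,1)$ for some $i$, $p(a,b\mid1,0)=0$ whenever $(a_i,b_i)=(1,0)$ for some $i$, and $p(a,b\mid1,1)=0$ whenever $(a_i,b_i)=(0,0)$ for some $i$; and let $p_H^N(p)=\sum_{a,b:\ \exists i,\ (a_i,b_i)=(0,0)}p(a,b\mid0,0)$. Then $p_N$ satisfies (Z) for every $N$, $p_H^N(p_N)\to1$ as $N\to\infty$, and for all $l>0$ and all $\varepsilon_A,\varepsilon_B\in[0,1)$ there is an $N$ such that no $l$-measurement dependent, $(\varepsilon_A,\varepsilon_B)$-parameter dependent hidden-variable model satisfying outcome independence (with settings $x,y\in\{0,1\}$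 and outcomes $a,b\in\{0,1\}^N$) produces a correlation $p$ satisfying (Z) with $p_H^N(p)=p_H^N(p_N)$.
   Context: Hidden-variable (HV) model: a probability space $(\Lambda,\mu)$ of hidden variables $\lambda$; for each $\lambda$ a probability distribution $p(x,y\mid\lambda)$ on pairs of settings; and for each $\lambda,x,y$ a probability distribution $p(a,b\mid\lambda,x,y)$ on pairs of outcomes (all measurable in $\lambda$). The setting distribution is $p(x,y)=\int p(x,y\mid\lambda)\,d\mu(\lambda)$, and the correlation produced is $$p(a,b\mid x,y)=\frac{1}{p(x,y)}\int p(x,y\mid\lambda)\,p(a,b\mid\lambda,x,y)\,d\mu(\lambda).$$ Marginals: $p(a\mid\lambda,x,y)=\sum_b p(a,b\mid\lambda,x,y)$ and $p(b\mid\lambda,x,y)=\sum_a p(a,b\mid\lambda,x,y)$. $l$-measurement dependent: $p(x,y\mid\lambda)\ge l$ for all $x,y,\lambda$. Outcome independence: $p(a,b\mid\lambda,x,y)=p(a\mid\lambda,x,y)\,p(b\mid\lambda,x,y)$ for all $a,b,x,y,\lambda$. $(\varepsilon_A,\varepsilon_B)$-parameter dependent: for all $\lambda$, all $x,y,y'$: $\frac12\sum_a|p(a\mid\lambda,x,y)-p(a\mid\lambda,x,y')|\le\varepsilon_A$; and for all $\lambda$, all $y,x,x'$: $\frac12\sum_b|p(b\mid\lambda,x,y)-p(b\mid\lambda,x',y)|\le\varepsilon_B$. *)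

theory Defs
  imports "HOL-Probability.Probability"
begin

text \<open>
  Settings and single-copy outcomes are elements of the two-element type \<^typ>\<open>2\<close>, whose elements
  are \<open>0\<close> and \<open>1\<close>. Outcomes in \<open>{0,1}\<^sup>N\<close> are lists of length \<open>N\<close>, with components indexed from
  \<open>0\<close> to \<open>N - 1\<close>. A value \<open>p a b x y\<close> of a correlation stands for \<open>p(a,b|x,y)\<close>; it is meaningful
  only for \<open>a\<close> and \<open>b\<close> in \<open>strings N\<close>.
\<close>

type_synonym correlation = "2 list \<Rightarrow> 2 list \<Rightarrow> 2 \<Rightarrow> 2 \<Rightarrow> real"

definition strings :: "nat \<Rightarrow> 2 list set" where
  "strings N = {a. length a = N}"


section \<open>Hidden-variable models\<close>

text \<open>
  \<open>q w x y\<close> is \<open>p(x,y|\<lambda>)\<close> and \<open>r w x y a b\<close> is \<open>p(a,b|\<lambda>,x,y)\<close>, where \<open>w\<close> plays the role of \<open>\<lambda>\<close>.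
\<close>

locale hv_model = prob_space M
  for M :: "'l measure" +
  fixes N :: nat
    and q :: "'l \<Rightarrow> 2 \<Rightarrow> 2 \<Rightarrow> real"
    and r :: "'l \<Rightarrow> 2 \<Rightarrow> 2 \<Rightarrow> 2 list \<Rightarrow> 2 list \<Rightarrow> real"
  assumes q_measurable: "\<And>x y. (\<lambda>w. q w x y) \<in> borel_measurable M"
    and q_nonneg: "\<And>w x y. w \<in> space M \<Longrightarrow> 0 \<le> q w x y"
    and q_sum: "\<And>w. w \<in> space M \<Longrightarrow> (\<Sum>x\<in>UNIV. \<Sum>y\<in>UNIV. q w x y) = 1"
    and r_measurable: "\<And>x y a b. a \<in> strings N \<Longrightarrow> b \<in> strings N \<Longrightarrow>
        (\<lambda>w. r w x y a b) \<in> borel_measurable M"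
    and r_nonneg: "\<And>w x y a b. w \<in> space M \<Longrightarrow> a \<in> strings N \<Longrightarrow> b \<in> strings N \<Longrightarrow>
        0 \<le> r w x y a b"
    and r_sum: "\<And>w x y. w \<in> space M \<Longrightarrow> (\<Sum>a\<in>strings N. \<Sum>b\<in>strings N. r w x y a b) = 1"

definition hv_settings :: "'l measure \<Rightarrow> ('l \<Rightarrow> 2 \<Rightarrow> 2 \<Rightarrow> real) \<Rightarrow> 2 \<Rightarrow> 2 \<Rightarrow> real" where
  "hv_settings M q x y = (\<integral>w. q w x y \<partial>M)"

definition hv_correlation ::
  "'l measure \<Rightarrow> ('l \<Rightarrow> 2 \<Rightarrow> 2 \<Rightarrow> real) \<Rightarrow> ('l \<Rightarrow> 2 \<Rightarrow> 2 \<Rightarrow> 2 list \<Rightarrow> 2 list \<Rightarrow> real) \<Rightarrow> correlation" where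
  "hv_correlation M q r a b x y =
     1 / hv_settings M q x y * (\<integral>w. q w x y * r w x y a b \<partial>M)"

definition marginal_A ::
  "nat \<Rightarrow> ('l \<Rightarrow> 2 \<Rightarrow> 2 \<Rightarrow> 2 list \<Rightarrow> 2 list \<Rightarrow> real) \<Rightarrow> 'l \<Rightarrow> 2 \<Rightarrow> 2 \<Rightarrow> 2 list \<Rightarrow> real" where
  "marginal_A N r w x y a = (\<Sum>b\<in>strings N. r w x y a b)"

definition marginal_B ::
  "nat \<Rightarrow> ('l \<Rightarrow> 2 \<Rightarrow> 2 \<Rightarrow> 2 list \<Rightarrow> 2 list \<Rightarrow> real) \<Rightarrow> 'l \<Rightarrow> 2 \<Rightarrow> 2 \<Rightarrow> 2 list \<Rightarrow> real" where
  "marginal_B N r w x y b = (\<Sum>a\<in>strings N. r w x y a b)"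

definition measurement_dependent ::
  "'l measure \<Rightarrow> real \<Rightarrow> ('l \<Rightarrow> 2 \<Rightarrow> 2 \<Rightarrow> real) \<Rightarrow> bool" where
  "measurement_dependent M l q \<longleftrightarrow> (\<forall>w\<in>space M. \<forall>x y. l \<le> q w x y)"

definition outcome_independent ::
  "'l measure \<Rightarrow> nat \<Rightarrow> ('l \<Rightarrow> 2 \<Rightarrow> 2 \<Rightarrow> 2 list \<Rightarrow> 2 list \<Rightarrow> real) \<Rightarrow> bool" where
  "outcome_independent M N r \<longleftrightarrow>
     (\<forall>w\<in>space M. \<forall>x y. \<forall>a\<in>strings N. \<forall>b\<in>strings N.
        r w x y a b = marginal_A N r w x y a * marginal_B N r w x y b)"

definition parameter_dependent ::
  "'l measure \<Rightarrow> nat \<Rightarrow> real \<Rightarrow> real \<Rightarrow> ('l \<Rightarrow> 2 \<Rightarrow> 2 \<Rightarrow> 2 list \<Rightarrow> 2 list \<Rightarrow> real) \<Rightarrow> bool" where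
  "parameter_dependent M N \<epsilon>\<^sub>A \<epsilon>\<^sub>B r \<longleftrightarrow>
     (\<forall>w\<in>space M. \<forall>x y y'.
        1/2 * (\<Sum>a\<in>strings N. \<bar>marginal_A N r w x y a - marginal_A N r w x y' a\<bar>) \<le> \<epsilon>\<^sub>A) \<and>
     (\<forall>w\<in>space M. \<forall>y x x'.
        1/2 * (\<Sum>b\<in>strings N. \<bar>marginal_B N r w x y b - marginal_B N r w x' y b\<bar>) \<le> \<epsilon>\<^sub>B)"

text \<open>
  The argument of type \<^typ>\<open>'l itself\<close> names the type from which the hidden variables are drawn;
  the hidden-variable space itself is any probability space on any subset of that type.

  HOL cannot quantify over types inside a formula, so ``there is an \<open>N\<close> such that no model on any
  space \<open>\<Lambda>\<close>'' cannot be written directly, and a type variable for \<open>\<Lambda>\<close> would let \<open>N\<close> depend on that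
  type. Instead \<open>N\<close> is chosen for the fixed type \<^typ>\<open>nat \<Rightarrow> real\<close>, together with the claim that
  every correlation produced by a model on an arbitrary type \<^typ>\<open>'l\<close> is produced, with the same
  parameters, by a model on \<^typ>\<open>nat \<Rightarrow> real\<close>. Jointly these exclude models on all types for one
  and the same \<open>N\<close>.
\<close>

definition hv_produces ::
  "'l itself \<Rightarrow> nat \<Rightarrow> real \<Rightarrow> real \<Rightarrow> real \<Rightarrow> correlation \<Rightarrow> bool" where
  "hv_produces _ N l \<epsilon>\<^sub>A \<epsilon>\<^sub>B p \<longleftrightarrow>
     (\<exists>(M :: 'l measure) q r.
        hv_model M N q r \<and> measurement_dependent M l q \<and> outcome_independent M N r \<and>
        parameter_dependent M N \<epsilon>\<^sub>A \<epsilon>\<^sub>B r \<and>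
        (\<forall>a\<in>strings N. \<forall>b\<in>strings N. \<forall>x y. p a b x y = hv_correlation M q r a b x y))"


section \<open>The zero conditions and the Hardy probability\<close>

definition cond_Z :: "nat \<Rightarrow> correlation \<Rightarrow> bool" where
  "cond_Z N p \<longleftrightarrow>
     (\<forall>a\<in>strings N. \<forall>b\<in>strings N.
        ((\<exists>i<N. (a ! i, b ! i) = (0, 1)) \<longrightarrow> p a b 0 1 = 0) \<and>
        ((\<exists>i<N. (a ! i, b ! i) = (1, 0)) \<longrightarrow> p a b 1 0 = 0) \<and>
        ((\<exists>i<N. (a ! i, b ! i) = (0, 0)) \<longrightarrow> p a b 1 1 = 0))"

definition p_Hardy :: "nat \<Rightarrow> correlation \<Rightarrow> real" where
  "p_Hardy N p =
     (\<Sum>(a, b)\<in>{(a, b). a \<in> strings N \<and> b \<in> strings N \<and> (\<exists>i<N. (a ! i, b ! i) = (0, 0))}. p a b 0 0)"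


section \<open>The quantum correlation\<close>

text \<open>
  Qubit vectors are indexed by \<^typ>\<open>2\<close> and two-qubit vectors by pairs, so that \<open>|i j\<rangle>\<close> is the
  basis vector with index \<open>(i, j)\<close>.
\<close>

definition ket :: "2 \<Rightarrow> complex ^ 2" where
  "ket i = axis i 1"

definition tensor_vec :: "complex ^ 2 \<Rightarrow> complex ^ 2 \<Rightarrow> complex ^ (2 \<times> 2)" where
  "tensor_vec u v = (\<chi> k. u $ fst k * v $ snd k)"

definition tensor_op :: "complex ^ 2 ^ 2 \<Rightarrow> complex ^ 2 ^ 2 \<Rightarrow> complex ^ (2 \<times> 2) ^ (2 \<times> 2)" where
  "tensor_op A B = (\<chi> k m. A $ fst k $ fst m * B $ snd k $ snd m)"

definition braket :: "complex ^ 'n \<Rightarrow> complex ^ 'n \<Rightarrow> complex" where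
  "braket u v = (\<Sum>k\<in>UNIV. cnj (u $ k) * v $ k)"

definition ketbra :: "complex ^ 'n \<Rightarrow> complex ^ 'n ^ 'n" where
  "ketbra u = (\<chi> i j. u $ i * cnj (u $ j))"

definition s_amp :: real where
  "s_amp = (sqrt 5 - 1) / 2"

definition phi_state :: "complex ^ (2 \<times> 2)" where
  "phi_state = s_amp *\<^sub>R (tensor_vec (ket 0) (ket 1) + tensor_vec (ket 1) (ket 0)) +
     sqrt (1 - 2 * s_amp\<^sup>2) *\<^sub>R tensor_vec (ket 1) (ket 1)"

definition varphi :: "complex ^ 2" where
  "varphi = (1 / sqrt (1 - s_amp\<^sup>2)) *\<^sub>R (sqrt (1 - 2 * s_amp\<^sup>2) *\<^sub>R ket 0 - s_amp *\<^sub>R ket 1)"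

text \<open>
  \<open>projA a x\<close> is \<open>A\<^bsub>a|x\<^esub>\<close> and \<open>projB b y\<close> is \<open>B\<^bsub>b|y\<^esub>\<close>.
\<close>

definition projA :: "2 \<Rightarrow> 2 \<Rightarrow> complex ^ 2 ^ 2" where
  "projA a x = (let P = (if x = 0 then ketbra varphi else ketbra (ket 0)) in
     if a = 0 then P else mat 1 - P)"

definition projB :: "2 \<Rightarrow> 2 \<Rightarrow> complex ^ 2 ^ 2" where
  "projB b y = projA b y"

text \<open>
  \<open>tensor_op (projA \<alpha> x) (projB \<beta> y)\<close> is Hermitian, so its expectation value is real and taking the
  real part only changes the type.
\<close>

definition single_copy :: "2 \<Rightarrow> 2 \<Rightarrow> 2 \<Rightarrow> 2 \<Rightarrow> real" where
  "single_copy \<alpha> \<beta> x y =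
     Re (braket phi_state (tensor_op (projA \<alpha> x) (projB \<beta> y) *v phi_state))"

definition p_quantum :: "nat \<Rightarrow> correlation" where
  "p_quantum N a b x y = (\<Prod>i<N. single_copy (a ! i) (b ! i) x y)"

end

theory Submission
  imports Defs
begin

section \<open>The quantum correlation\<close>

text \<open>The proof is a gap between two numbers. On the quantum side one copy has the zeros
  demanded by (Z) and yields \<open>(0,0)\<close> at the settings \<open>(0,0)\<close> with
  probability h = s^2 (2 s - 1) > 0. Copies are independent, so the Hardy event over N copies has
  probability 1 - (1 - h)^N, which tends to 1 (\<open>p_Hardy_p_quantum\<close>).

  On the hidden-variable side, l > 0 forces a zero of the correlation to be a zero of
  \<open>r w\<close> for almost every \<open>w\<close> (\<open>AE_r_eq_0\<close>), so (Z) holds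
  pointwise almost everywhere. For such a \<open>w\<close>, parameter dependence below 1 makes the
  supports of marginals at neighbouring settings overlap; together with outcome independence and (Z)
  this leaves mass at least \<open>(1 - \<epsilon>\<^sub>A) * (1 - \<epsilon>\<^sub>B)\<close>
  outside the Hardy event (\<open>Hardy_probability_le\<close>). Averaging over \<open>w\<close>
  keeps the bound (\<open>p_Hardy_hv_correlation_le\<close>), which involves neither N nor l, so the
  quantum value exceeds it for large N.

  The choice of hidden-variable type is immaterial, because a model can be pushed forward to the
  vector of its finitely many relevant probabilities (\<open>hv_produces_nat_real\<close>).\<close>

lemma UNIV_2_zero_one: "(UNIV :: 2 set) = {0, 1}"
  using UNIV_2 by auto

lemma exhaust_2_zero_one: "(x :: 2) = 0 \<or> x = 1"
  using UNIV_2_zero_one by blast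

lemma UNIV_2_times_2:
  "(UNIV :: (2 \<times> 2) set) = {(0, 0), (0, 1), (1, 0), (1, 1)}"
  by (auto simp: UNIV_2_zero_one simp flip: UNIV_Times_UNIV)

text \<open>The amplitude is the positive root of s^2 + s = 1; this relation collapses all later
  constants to polynomials in s.\<close>

lemma s_amp_squared: "s_amp\<^sup>2 = 1 - s_amp"
  by (simp add: s_amp_def power2_eq_square field_simps)

text \<open>The lower bound makes 1 - 2 s^2 = 2 s - 1 positive, hence also the single-copy Hardy
  probability.\<close>

lemma s_amp_bounds: "1 / 2 < s_amp" "s_amp < 1"
proof -
  have "2 < sqrt 5" by (rule real_less_rsqrt) simp
  moreover have "sqrt 5 < 3" by (rule real_less_lsqrt) simp_all
  ultimately show "1 / 2 < s_amp" "s_amp < 1" by (simp_all add: s_amp_def)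
qed

section \<open>One copy in real coordinates\<close>

definition c_amp :: real where
  "c_amp = sqrt (1 - 2 * s_amp\<^sup>2)"

definition varphi_re :: "2 \<Rightarrow> real" where
  "varphi_re i = (if i = 0 then c_amp else - s_amp) / sqrt (1 - s_amp\<^sup>2)"

lemma c_amp_squared: "c_amp\<^sup>2 = 2 * s_amp - 1"
  using s_amp_bounds by (simp add: c_amp_def s_amp_squared)

text \<open>\<open>varphi\<close> is orthogonal to (s, c), the unnormalised state of one qubit once
  the other is found in |1>. This is the source of the zeros at the settings \<open>(0,1)\<close>
  and \<open>(1,0)\<close>.\<close>

lemma varphi_re_orthogonal: "s_amp * varphi_re 0 = - c_amp * varphi_re 1"
  by (simp add: varphi_re_def)

lemma varphi_re_1_squared: "(varphi_re 1)\<^sup>2 = s_amp"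
proof -
  have "1 - s_amp\<^sup>2 = s_amp" by (simp add: s_amp_squared)
  then show ?thesis
    using s_amp_bounds by (simp add: varphi_re_def power_divide) (simp add: power2_eq_square)
qed

lemma phi_state_components:
  "phi_state $ (0, 0) = 0" "phi_state $ (0, 1) = of_real s_amp"
  "phi_state $ (1, 0) = of_real s_amp" "phi_state $ (1, 1) = of_real c_amp"
  by (simp_all add: phi_state_def tensor_vec_def ket_def axis_def c_amp_def,
      simp_all add: scaleR_conv_of_real)

lemma varphi_components: "varphi $ i = of_real (varphi_re i)"
  using exhaust_2_zero_one[of i]
  by (auto simp: varphi_def ket_def axis_def varphi_re_def c_amp_def) (simp_all add: scaleR_conv_of_real)

definition projA_re :: "2 \<Rightarrow> 2 \<Rightarrow> 2 \<Rightarrow> 2 \<Rightarrow> real" where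
  "projA_re a x i j =
     (let P = (if x = 0 then varphi_re i * varphi_re j else if i = 0 \<and> j = 0 then 1 else 0)
      in if a = 0 then P else (if i = j then 1 else 0) - P)"

lemma projA_components: "projA a x $ i $ j = of_real (projA_re a x i j)"
  using exhaust_2_zero_one[of i] exhaust_2_zero_one[of j]
  by (auto simp: projA_def ketbra_def mat_def Let_def projA_re_def varphi_components ket_def axis_def)

text \<open>The state has no |00> component, so nine of the sixteen terms survive; all entries are
  real.\<close>

lemma single_copy_expand:
  fixes \<alpha> \<beta> x y
  defines "A \<equiv> projA_re \<alpha> x" and "B \<equiv> projA_re \<beta> y"
  shows "single_copy \<alpha> \<beta> x y =
       s_amp * (A 0 0 * B 1 1 * s_amp + A 0 1 * B 1 0 * s_amp + A 0 1 * B 1 1 * c_amp)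
     + s_amp * (A 1 0 * B 0 1 * s_amp + A 1 1 * B 0 0 * s_amp + A 1 1 * B 0 1 * c_amp)
     + c_amp * (A 1 0 * B 1 1 * s_amp + A 1 1 * B 1 0 * s_amp + A 1 1 * B 1 1 * c_amp)"
  unfolding A_def B_def
  by (simp add: single_copy_def braket_def tensor_op_def matrix_vector_mult_def projB_def
      UNIV_2_times_2 phi_state_components projA_components add.assoc)

lemma single_copy_zeros:
  "single_copy 0 1 0 1 = 0" "single_copy 1 0 1 0 = 0" "single_copy 0 0 1 1 = 0"
proof -
  let ?v = "varphi_re"
  have "single_copy 0 1 0 1 = (s_amp * ?v 0 + c_amp * ?v 1)\<^sup>2"
    "single_copy 1 0 1 0 = (s_amp * ?v 0 + c_amp * ?v 1)\<^sup>2"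
    by (simp_all add: single_copy_expand projA_re_def power2_eq_square algebra_simps)
  then show "single_copy 0 1 0 1 = 0" "single_copy 1 0 1 0 = 0"
    by (simp_all add: varphi_re_orthogonal)
qed (simp add: single_copy_expand projA_re_def)

text \<open>The probability is the square of the amplitude of \<open>phi_state\<close> along
  \<open>varphi\<close> tensor \<open>varphi\<close>, which orthogonality reduces to -c times
  \<open>(varphi_re 1)\<^sup>2\<close>.\<close>

lemma single_copy_Hardy: "single_copy 0 0 0 0 = s_amp\<^sup>2 * (2 * s_amp - 1)"
proof -
  let ?v = "varphi_re"
  have "single_copy 0 0 0 0 = (2 * (s_amp * ?v 0) * ?v 1 + c_amp * (?v 1)\<^sup>2)\<^sup>2"
    by (simp add: single_copy_expand projA_re_def power2_eq_square algebra_simps)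
  also have "\<dots> = c_amp\<^sup>2 * ((?v 1)\<^sup>2)\<^sup>2"
    unfolding varphi_re_orthogonal by (simp add: power2_eq_square algebra_simps)
  finally show ?thesis by (simp add: c_amp_squared varphi_re_1_squared)
qed

text \<open>The projectors on each side add up to the identity, so the sum is the squared norm of
  the state.\<close>

lemma single_copy_sum: "(\<Sum>\<alpha>\<in>UNIV. \<Sum>\<beta>\<in>UNIV. single_copy \<alpha> \<beta> 0 0) = 1"
proof -
  have "(\<Sum>\<alpha>\<in>UNIV. \<Sum>\<beta>\<in>UNIV. single_copy \<alpha> \<beta> 0 0) = 2 * s_amp\<^sup>2 + c_amp\<^sup>2"
    by (simp add: UNIV_2_zero_one single_copy_expand projA_re_def)
       (simp add: algebra_simps power2_eq_square)
  then show ?thesis by (simp add: c_amp_squared s_amp_squared)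
qed

lemma cond_Z_p_quantum: "cond_Z N (p_quantum N)"
proof -
  have "p_quantum N a b x y = 0"
    if "i < N" "(a ! i, b ! i) = (\<alpha>, \<beta>)" "single_copy \<alpha> \<beta> x y = 0" for a b x y \<alpha> \<beta> i
    unfolding p_quantum_def using that by (intro prod_zero) auto
  then show ?thesis
    unfolding cond_Z_def using single_copy_zeros by blast
qed

lemma cond_ZD:
  assumes "cond_Z N p" "a \<in> strings N" "b \<in> strings N" "i < N"
  shows "a ! i = 0 \<Longrightarrow> b ! i = 1 \<Longrightarrow> p a b 0 1 = 0"
    and "a ! i = 1 \<Longrightarrow> b ! i = 0 \<Longrightarrow> p a b 1 0 = 0"
    and "a ! i = 0 \<Longrightarrow> b ! i = 0 \<Longrightarrow> p a b 1 1 = 0"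
  using assms unfolding cond_Z_def prod.inject by blast+

section \<open>Sums over strings and the N-copy Hardy probability\<close>

lemma finite_strings [simp]: "finite (strings N)"
  using finite_lists_length_eq[of "UNIV :: 2 set" N] by (simp add: strings_def)

lemma sum_strings_Suc:
  "(\<Sum>a\<in>strings (Suc N). g a) = (\<Sum>\<alpha>\<in>UNIV. \<Sum>a\<in>strings N. g (\<alpha> # a))"
  for g :: "2 list \<Rightarrow> real"
proof -
  have "strings (Suc N) = (\<lambda>(\<alpha>, a). \<alpha> # a) ` (UNIV \<times> strings N)"
    by (auto simp: strings_def length_Suc_conv image_iff)
  moreover have "inj_on (\<lambda>(\<alpha>, a). \<alpha> # a) (UNIV \<times> strings N)"
    by (auto simp: inj_on_def)
  ultimately show ?thesis
    by (simp add: sum.reindex sum.cartesian_product case_prod_unfold)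
qed

lemma sum_strings_prod:
  "(\<Sum>a\<in>strings N. \<Sum>b\<in>strings N. \<Prod>i<N. f (a ! i) (b ! i)) = (\<Sum>\<alpha>\<in>UNIV. \<Sum>\<beta>\<in>UNIV. f \<alpha> \<beta>) ^ N"
  for f :: "2 \<Rightarrow> 2 \<Rightarrow> real"
proof (induction N)
  case 0
  then show ?case by (simp add: strings_def)
next
  case (Suc N)
  let ?P = "\<lambda>a b. \<Prod>i<N. f (a ! i) (b ! i)"
  have "(\<Sum>a\<in>strings (Suc N). \<Sum>b\<in>strings (Suc N). \<Prod>i<Suc N. f (a ! i) (b ! i))
      = (\<Sum>\<alpha>\<in>UNIV. \<Sum>a\<in>strings N. \<Sum>\<beta>\<in>UNIV. \<Sum>b\<in>strings N. f \<alpha> \<beta> * ?P a b)"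
    by (simp add: sum_strings_Suc prod.lessThan_Suc_shift del: prod.lessThan_Suc)
  also have "\<dots> = (\<Sum>\<alpha>\<in>UNIV. \<Sum>\<beta>\<in>UNIV. \<Sum>a\<in>strings N. \<Sum>b\<in>strings N. f \<alpha> \<beta> * ?P a b)"
    by (intro sum.cong refl sum.swap)
  also have "\<dots> = (\<Sum>\<alpha>\<in>UNIV. \<Sum>\<beta>\<in>UNIV. f \<alpha> \<beta>) * (\<Sum>a\<in>strings N. \<Sum>b\<in>strings N. ?P a b)"
    by (simp add: sum_distrib_right flip: sum_distrib_left)
  finally show ?case by (simp add: Suc.IH)
qed

definition Hardy_event :: "nat \<Rightarrow> 2 list \<Rightarrow> 2 list \<Rightarrow> bool" where
  "Hardy_event N a b \<longleftrightarrow> (\<exists>i<N. (a ! i, b ! i) = (0, 0))"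

lemma p_Hardy_iterated_sum:
  "p_Hardy N p = (\<Sum>a\<in>strings N. \<Sum>b\<in>strings N. if Hardy_event N a b then p a b 0 0 else 0)"
proof -
  have "p_Hardy N p = (\<Sum>(a, b)\<in>strings N \<times> strings N. if Hardy_event N a b then p a b 0 0 else 0)"
    unfolding p_Hardy_def
    by (rule sum.mono_neutral_cong_left) (auto simp: Hardy_event_def split: if_splits)
  then show ?thesis by (simp add: sum.cartesian_product)
qed

lemma p_Hardy_p_quantum: "p_Hardy N (p_quantum N) = 1 - (1 - single_copy 0 0 0 0) ^ N"
proof -
  \<comment> \<open>Deleting the pair \<open>(0,0)\<close> from each factor turns the product into
    the probability restricted to the complement of the Hardy event, whose total is again an N-th
    power.\<close>
  define f where "f \<alpha> \<beta> = (if (\<alpha>, \<beta>) = (0, 0) then 0 else single_copy \<alpha> \<beta> 0 0)" for \<alpha> \<beta>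
  have "p_quantum N a b 0 0 - (\<Prod>i<N. f (a ! i) (b ! i))
      = (if Hardy_event N a b then p_quantum N a b 0 0 else 0)" for a b
  proof (cases "Hardy_event N a b")
    case True
    then have "(\<Prod>i<N. f (a ! i) (b ! i)) = 0"
      by (intro prod_zero) (auto simp: Hardy_event_def f_def)
    with True show ?thesis by simp
  next
    case False
    then have "(\<Prod>i<N. f (a ! i) (b ! i)) = p_quantum N a b 0 0"
      unfolding p_quantum_def by (intro prod.cong) (auto simp: Hardy_event_def f_def)
    with False show ?thesis by simp
  qed
  then have "p_Hardy N (p_quantum N) =
      (\<Sum>a\<in>strings N. \<Sum>b\<in>strings N. p_quantum N a b 0 0 - (\<Prod>i<N. f (a ! i) (b ! i)))"
    by (simp add: p_Hardy_iterated_sum)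
  also have "\<dots> = (\<Sum>\<alpha>\<in>UNIV. \<Sum>\<beta>\<in>UNIV. single_copy \<alpha> \<beta> 0 0) ^ N - (\<Sum>\<alpha>\<in>UNIV. \<Sum>\<beta>\<in>UNIV. f \<alpha> \<beta>) ^ N"
    by (simp add: sum_subtractf p_quantum_def sum_strings_prod[of "\<lambda>\<alpha> \<beta>. single_copy \<alpha> \<beta> 0 0"]
        sum_strings_prod[of f])
  also have "(\<Sum>\<alpha>\<in>UNIV. \<Sum>\<beta>\<in>UNIV. f \<alpha> \<beta>)
      = (\<Sum>\<alpha>\<in>UNIV. \<Sum>\<beta>\<in>UNIV. single_copy \<alpha> \<beta> 0 0) - single_copy 0 0 0 0"
    by (simp add: UNIV_2_zero_one f_def)
  finally show ?thesis by (simp add: single_copy_sum)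
qed

lemma p_Hardy_p_quantum_tendsto: "(\<lambda>N. p_Hardy N (p_quantum N)) \<longlonglongrightarrow> 1"
proof -
  let ?h = "single_copy 0 0 0 0"
  have "0 < ?h" using s_amp_bounds by (simp add: single_copy_Hardy)
  moreover have "?h \<le> 1"
    unfolding single_copy_Hardy using s_amp_bounds by (intro mult_le_one power_le_one) auto
  ultimately have "(\<lambda>N. 1 - (1 - ?h) ^ N) \<longlonglongrightarrow> 1 - 0"
    by (intro tendsto_diff tendsto_const LIMSEQ_realpow_zero) auto
  then show ?thesis by (simp add: p_Hardy_p_quantum)
qed


section \<open>Hidden-variable models\<close>

lemma sum_on_support_ge:
  fixes \<alpha> \<alpha>' :: "'a \<Rightarrow> real"
  assumes "finite S" and "sum \<alpha> S = 1" "sum \<alpha>' S = 1"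
    and tv: "1 / 2 * (\<Sum>a\<in>S. \<bar>\<alpha> a - \<alpha>' a\<bar>) \<le> \<epsilon>"
  shows "1 - \<epsilon> \<le> (\<Sum>a\<in>{a \<in> S. \<alpha>' a \<noteq> 0}. \<alpha> a)"
proof -
  define U where "U = {a \<in> S. \<alpha>' a \<noteq> 0}"
  have U: "finite U" "U \<subseteq> S" using \<open>finite S\<close> by (auto simp: U_def)
  have "sum \<alpha>' U = sum \<alpha>' S"
    by (rule sum.mono_neutral_left) (use \<open>finite S\<close> in \<open>auto simp: U_def\<close>)
  moreover have "sum \<alpha> S = sum \<alpha> U + sum \<alpha> (S - U)"
    using U \<open>finite S\<close> by (metis sum.subset_diff add.commute)
  ultimately have eqs: "sum \<alpha>' U = 1" "sum \<alpha> (S - U) = 1 - sum \<alpha> U"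
    using assms by auto
  \<comment> \<open>Both parts of the absolute sum are at least \<open>1 - sum \<alpha> U\<close>:
    on \<open>U\<close> because \<open>\<alpha>'\<close> has all its mass there, off
    \<open>U\<close> because \<open>\<alpha>'\<close> vanishes. The factor 1/2 absorbs the double
    count.\<close>
  have "sum \<alpha>' U - sum \<alpha> U \<le> (\<Sum>a\<in>U. \<bar>\<alpha> a - \<alpha>' a\<bar>)"
    by (subst sum_subtractf[symmetric]) (rule sum_mono, simp)
  moreover have "sum \<alpha> (S - U) \<le> (\<Sum>a\<in>S - U. \<bar>\<alpha> a - \<alpha>' a\<bar>)"
    by (rule sum_mono) (auto simp: U_def)
  moreover have "(\<Sum>a\<in>S. \<bar>\<alpha> a - \<alpha>' a\<bar>)
      = (\<Sum>a\<in>U. \<bar>\<alpha> a - \<alpha>' a\<bar>) + (\<Sum>a\<in>S - U. \<bar>\<alpha> a - \<alpha>' a\<bar>)"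
    using U \<open>finite S\<close> by (metis sum.subset_diff add.commute)
  ultimately have "1 - \<epsilon> \<le> sum \<alpha> U" using tv eqs by linarith
  then show ?thesis by (simp add: U_def)
qed

lemma ex_common_support:
  fixes \<alpha> \<alpha>' :: "'a \<Rightarrow> real"
  assumes "finite S" and "sum \<alpha> S = 1" "sum \<alpha>' S = 1"
    and "1 / 2 * (\<Sum>a\<in>S. \<bar>\<alpha> a - \<alpha>' a\<bar>) \<le> \<epsilon>" and "\<epsilon> < 1"
  shows "\<exists>a\<in>S. \<alpha> a \<noteq> 0 \<and> \<alpha>' a \<noteq> 0"
proof (rule ccontr)
  assume "\<not> ?thesis"
  then have "(\<Sum>a\<in>{a \<in> S. \<alpha>' a \<noteq> 0}. \<alpha> a) = 0"
    by (intro sum.neutral) auto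
  with sum_on_support_ge[OF assms(1-4)] \<open>\<epsilon> < 1\<close> show False by linarith
qed

context hv_model
begin

lemma marginal_A_sum: "w \<in> space M \<Longrightarrow> (\<Sum>a\<in>strings N. marginal_A N r w x y a) = 1"
  by (simp add: marginal_A_def r_sum)

lemma marginal_B_sum: "w \<in> space M \<Longrightarrow> (\<Sum>b\<in>strings N. marginal_B N r w x y b) = 1"
  by (subst r_sum[of w x y, symmetric]) (auto simp: marginal_B_def intro: sum.swap)

lemma marginal_A_nonneg: "w \<in> space M \<Longrightarrow> a \<in> strings N \<Longrightarrow> 0 \<le> marginal_A N r w x y a"
  by (auto simp: marginal_A_def intro!: sum_nonneg r_nonneg)

lemma marginal_B_nonneg: "w \<in> space M \<Longrightarrow> b \<in> strings N \<Longrightarrow> 0 \<le> marginal_B N r w x y b"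
  by (auto simp: marginal_B_def intro!: sum_nonneg r_nonneg)

text \<open>
  Write \<open>Z(a)\<close> for the set of positions of the zeros of \<open>a\<close>. Since \<open>\<epsilon>\<^sub>A, \<epsilon>\<^sub>B < 1\<close>, some \<open>a\<^sub>*\<close> has positive
  probability for the settings \<open>(1,0)\<close> and \<open>(1,1)\<close>, and some \<open>b\<^sub>*\<close> for \<open>(0,1)\<close> and \<open>(1,1)\<close>. The
  zero conditions give \<open>Z(a\<^sub>*) \<inter> Z(b\<^sub>*) = {}\<close>, \<open>Z(a) \<subseteq> Z(b\<^sub>*)\<close> for every \<open>a\<close> possible at \<open>(0,1)\<close>, and
  \<open>Z(b) \<subseteq> Z(a\<^sub>*)\<close> for every \<open>b\<close> possible at \<open>(1,0)\<close>. So the Hardy event fails for all such pairs,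
  which have probability at least \<open>(1 - \<epsilon>\<^sub>A) (1 - \<epsilon>\<^sub>B)\<close> at \<open>(0,0)\<close>.
\<close>

lemma Hardy_probability_le:
  assumes w: "w \<in> space M"
    and oi: "outcome_independent M N r" and pd: "parameter_dependent M N \<epsilon>\<^sub>A \<epsilon>\<^sub>B r"
    and "\<epsilon>\<^sub>A < 1" "\<epsilon>\<^sub>B < 1" and zero: "cond_Z N (\<lambda>a b x y. r w x y a b)"
  shows "(\<Sum>a\<in>strings N. \<Sum>b\<in>strings N. if Hardy_event N a b then r w 0 0 a b else 0)
    \<le> 1 - (1 - \<epsilon>\<^sub>A) * (1 - \<epsilon>\<^sub>B)"
proof -
  let ?S = "strings N"
  let ?A = "marginal_A N r w" and ?B = "marginal_B N r w"
  have fact: "r w x y a b = ?A x y a * ?B x y b" if "a \<in> ?S" "b \<in> ?S" for x y a b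
    using oi w that by (auto simp: outcome_independent_def)
  have tvA: "1 / 2 * (\<Sum>a\<in>?S. \<bar>?A x y a - ?A x y' a\<bar>) \<le> \<epsilon>\<^sub>A" for x y y'
    using pd w by (auto simp: parameter_dependent_def)
  have tvB: "1 / 2 * (\<Sum>b\<in>?S. \<bar>?B x y b - ?B x' y b\<bar>) \<le> \<epsilon>\<^sub>B" for x x' y
    using pd w by (auto simp: parameter_dependent_def)
  obtain a0 where a0: "a0 \<in> ?S" "?A 1 0 a0 \<noteq> 0" "?A 1 1 a0 \<noteq> 0"
    using ex_common_support[OF finite_strings marginal_A_sum[OF w] marginal_A_sum[OF w] tvA \<open>\<epsilon>\<^sub>A < 1\<close>]
    by blast
  obtain b0 where b0: "b0 \<in> ?S" "?B 0 1 b0 \<noteq> 0" "?B 1 1 b0 \<noteq> 0"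
    using ex_common_support[OF finite_strings marginal_B_sum[OF w] marginal_B_sum[OF w] tvB \<open>\<epsilon>\<^sub>B < 1\<close>]
    by blast
  define U where "U = {a \<in> ?S. ?A 0 1 a \<noteq> 0}"
  define V where "V = {b \<in> ?S. ?B 1 0 b \<noteq> 0}"
  have no_Hardy: "\<not> Hardy_event N a b" if "a \<in> U" "b \<in> V" for a b
  proof
    assume "Hardy_event N a b"
    then obtain i where i: "i < N" "a ! i = 0" "b ! i = 0"
      by (auto simp: Hardy_event_def)
    have "a \<in> ?S" "b \<in> ?S" using that by (auto simp: U_def V_def)
    then have pos: "r w 0 1 a b0 \<noteq> 0" "r w 1 0 a0 b \<noteq> 0" "r w 1 1 a0 b0 \<noteq> 0"
      using a0 b0 that by (auto simp: fact U_def V_def)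
    have "b0 ! i = 0"
      using cond_ZD(1)[OF zero \<open>a \<in> ?S\<close> b0(1) \<open>i < N\<close>] pos(1) i exhaust_2_zero_one by blast
    moreover have "a0 ! i = 0"
      using cond_ZD(2)[OF zero a0(1) \<open>b \<in> ?S\<close> \<open>i < N\<close>] pos(2) i exhaust_2_zero_one by blast
    ultimately show False
      using cond_ZD(3)[OF zero a0(1) b0(1) \<open>i < N\<close>] pos(3) by blast
  qed
  \<comment> \<open>Changing only the other party's setting leads from \<open>(0,1)\<close> to
    \<open>(0,0)\<close> for A and from \<open>(1,0)\<close> to \<open>(0,0)\<close> for B, so each
    support keeps its mass up to the allowed distance; outcome independence multiplies the
    two.\<close>
  have "(1 - \<epsilon>\<^sub>A) * (1 - \<epsilon>\<^sub>B) \<le> sum (?A 0 0) U * sum (?B 0 0) V"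
    unfolding U_def V_def
    using \<open>\<epsilon>\<^sub>A < 1\<close> \<open>\<epsilon>\<^sub>B < 1\<close>
    by (intro mult_mono sum_on_support_ge[OF finite_strings marginal_A_sum[OF w] marginal_A_sum[OF w] tvA]
        sum_on_support_ge[OF finite_strings marginal_B_sum[OF w] marginal_B_sum[OF w] tvB])
       (auto intro!: sum_nonneg marginal_A_nonneg w)
  also have "\<dots> = (\<Sum>a\<in>U. \<Sum>b\<in>V. r w 0 0 a b)"
    unfolding sum_product by (intro sum.cong) (auto simp: fact U_def V_def)
  also have "\<dots> = (\<Sum>a\<in>U. \<Sum>b\<in>V. if Hardy_event N a b then 0 else r w 0 0 a b)"
    using no_Hardy by (intro sum.cong) auto
  also have "\<dots> \<le> (\<Sum>a\<in>?S. \<Sum>b\<in>V. if Hardy_event N a b then 0 else r w 0 0 a b)"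
    by (rule sum_mono2) (auto simp: U_def V_def intro!: sum_nonneg r_nonneg w)
  also have "\<dots> \<le> (\<Sum>a\<in>?S. \<Sum>b\<in>?S. if Hardy_event N a b then 0 else r w 0 0 a b)"
    by (intro sum_mono sum_mono2) (auto simp: V_def intro!: r_nonneg w)
  also have "\<dots> = (\<Sum>a\<in>?S. \<Sum>b\<in>?S. r w 0 0 a b - (if Hardy_event N a b then r w 0 0 a b else 0))"
    by (intro sum.cong) auto
  also have "\<dots> = 1 - (\<Sum>a\<in>?S. \<Sum>b\<in>?S. if Hardy_event N a b then r w 0 0 a b else 0)"
    by (simp add: sum_subtractf r_sum w)
  finally show ?thesis by simp
qed

section \<open>From single hidden variables to the average\<close>

lemma q_le_1:
  assumes "w \<in> space M"
  shows "q w x y \<le> 1"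
proof -
  have "q w x y \<le> (\<Sum>y\<in>UNIV. q w x y)"
    by (rule member_le_sum) (auto intro: q_nonneg assms)
  also have "\<dots> \<le> (\<Sum>x\<in>UNIV. \<Sum>y\<in>UNIV. q w x y)"
    by (rule member_le_sum[where f = "\<lambda>x. \<Sum>y\<in>UNIV. q w x y"])
      (auto intro!: sum_nonneg q_nonneg assms)
  finally show ?thesis by (simp add: q_sum assms)
qed

lemma r_le_1:
  assumes "w \<in> space M" "a \<in> strings N" "b \<in> strings N"
  shows "r w x y a b \<le> 1"
proof -
  have "r w x y a b \<le> (\<Sum>b\<in>strings N. r w x y a b)"
    by (rule member_le_sum) (auto intro: r_nonneg assms)
  also have "\<dots> \<le> (\<Sum>a\<in>strings N. \<Sum>b\<in>strings N. r w x y a b)"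
    by (rule member_le_sum[where f = "\<lambda>a. \<Sum>b\<in>strings N. r w x y a b"])
      (auto intro!: sum_nonneg r_nonneg assms)
  finally show ?thesis by (simp add: r_sum assms)
qed

lemma integrable_q: "integrable M (\<lambda>w. q w x y)"
  by (rule integrable_const_bound[where B = 1])
    (auto intro: AE_I2 simp: q_nonneg q_le_1 q_measurable)

lemma integrable_q_r:
  assumes "a \<in> strings N" "b \<in> strings N"
  shows "integrable M (\<lambda>w. q w x y * r w x y a b)"
  by (rule integrable_const_bound[where B = 1])
    (auto intro!: AE_I2 mult_le_one borel_measurable_times
      simp: abs_mult q_nonneg q_le_1 r_nonneg r_le_1 q_measurable r_measurable assms)

text \<open>Rules out division by zero in \<open>hv_correlation\<close>, which would make the
  correlation vanish for trivial reasons.\<close>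

lemma hv_settings_pos:
  assumes "measurement_dependent M l q" "0 < l"
  shows "0 < hv_settings M q x y"
proof -
  have "(\<integral>w. l \<partial>M) \<le> hv_settings M q x y"
    unfolding hv_settings_def
    by (rule integral_mono) (use assms in \<open>auto simp: integrable_q measurement_dependent_def\<close>)
  with \<open>0 < l\<close> show ?thesis by (simp add: prob_space)
qed

text \<open>A nonnegative integrand with integral 0 vanishes almost everywhere, and the factor
  \<open>q w x y\<close>, being at least \<open>l > 0\<close>, can be cancelled.\<close>

lemma AE_r_eq_0:
  assumes md: "measurement_dependent M l q" "0 < l"
    and ab: "a \<in> strings N" "b \<in> strings N" and "hv_correlation M q r a b x y = 0"
  shows "AE w in M. r w x y a b = 0"
proof -
  have "(\<integral>w. q w x y * r w x y a b \<partial>M) = 0"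
    using assms(5) hv_settings_pos[OF md, of x y] by (auto simp: hv_correlation_def)
  moreover have "AE w in M. 0 \<le> q w x y * r w x y a b"
    by (auto intro!: AE_I2 simp: q_nonneg r_nonneg ab)
  ultimately have "AE w in M. q w x y * r w x y a b = 0"
    using integral_nonneg_eq_0_iff_AE[OF integrable_q_r[OF ab, of x y]] by blast
  then show ?thesis
    using AE_space
  proof eventually_elim
    case (elim w)
    then have "l \<le> q w x y" using md by (simp add: measurement_dependent_def)
    with elim \<open>0 < l\<close> show ?case by simp
  qed
qed

text \<open>Only finitely many settings and outcomes occur, so their exceptional null sets combine
  into one.\<close>

lemma AE_cond_Z:
  assumes md: "measurement_dependent M l q" "0 < l"
    and Z: "cond_Z N (hv_correlation M q r)"
  shows "AE w in M. cond_Z N (\<lambda>a b x y. r w x y a b)"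
proof -
  have "AE w in M. \<forall>a\<in>strings N. \<forall>b\<in>strings N. \<forall>x\<in>UNIV. \<forall>y\<in>UNIV.
      hv_correlation M q r a b x y = 0 \<longrightarrow> r w x y a b = 0"
    by (intro AE_finite_allI finite_strings finite_class.finite_UNIV AE_impI AE_r_eq_0[OF md])
  then show ?thesis
  proof eventually_elim
    case (elim w)
    with Z show ?case by (simp add: cond_Z_def)
  qed
qed

text \<open>The Hardy probability is the mean of the pointwise one, \<open>H w\<close>, under the
  weight \<open>q w 0 0 / ?P\<close> of total mass 1, so an almost-everywhere bound passes to
  it.\<close>

lemma p_Hardy_hv_correlation_le:
  assumes md: "measurement_dependent M l q" "0 < l"
    and oi: "outcome_independent M N r" and pd: "parameter_dependent M N \<epsilon>\<^sub>A \<epsilon>\<^sub>B r"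
    and \<epsilon>: "\<epsilon>\<^sub>A < 1" "\<epsilon>\<^sub>B < 1"
    and Z: "cond_Z N (hv_correlation M q r)"
  shows "p_Hardy N (hv_correlation M q r) \<le> 1 - (1 - \<epsilon>\<^sub>A) * (1 - \<epsilon>\<^sub>B)"
proof -
  let ?S = "strings N" and ?P = "hv_settings M q 0 0" and ?k = "1 - (1 - \<epsilon>\<^sub>A) * (1 - \<epsilon>\<^sub>B)"
  define H where "H w = (\<Sum>a\<in>?S. \<Sum>b\<in>?S. if Hardy_event N a b then r w 0 0 a b else 0)" for w
  have if_integrable: "integrable M (\<lambda>w. if Hardy_event N a b then q w 0 0 * r w 0 0 a b else 0)"
    if "a \<in> ?S" "b \<in> ?S" for a b
    using integrable_q_r[OF that] by (cases "Hardy_event N a b") simp_all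
  have qH: "q w 0 0 * H w
      = (\<Sum>a\<in>?S. \<Sum>b\<in>?S. if Hardy_event N a b then q w 0 0 * r w 0 0 a b else 0)" for w
    unfolding H_def sum_distrib_left by (intro sum.cong) auto
  have int_qH: "integrable M (\<lambda>w. q w 0 0 * H w)"
    unfolding qH by (intro Bochner_Integration.integrable_sum if_integrable)
  have "p_Hardy N (hv_correlation M q r)
      = (\<Sum>a\<in>?S. \<Sum>b\<in>?S. 1 / ?P * (\<integral>w. (if Hardy_event N a b then q w 0 0 * r w 0 0 a b else 0) \<partial>M))"
    unfolding p_Hardy_iterated_sum by (intro sum.cong) (auto simp: hv_correlation_def)
  also have "\<dots> = 1 / ?P * (\<integral>w. q w 0 0 * H w \<partial>M)"
    unfolding qH
    by (simp add: Bochner_Integration.integral_sum if_integrable flip: sum_distrib_left sum_divide_distrib)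
  also have "(\<integral>w. q w 0 0 * H w \<partial>M) \<le> (\<integral>w. q w 0 0 * ?k \<partial>M)"
  proof (rule integral_mono_AE[OF int_qH])
    show "AE w in M. q w 0 0 * H w \<le> q w 0 0 * ?k"
      using AE_cond_Z[OF md Z] AE_space
    proof eventually_elim
      case (elim w)
      then have "H w \<le> ?k"
        unfolding H_def by (intro Hardy_probability_le[OF _ oi pd \<epsilon>])
      with elim show ?case by (intro mult_left_mono q_nonneg)
    qed
  qed (simp add: integrable_q)
  also have "\<dots> = ?P * ?k" by (simp add: hv_settings_def)
  finally show ?thesis
    using hv_settings_pos[OF md, of 0 0] by (simp add: divide_right_mono)
qed

end

lemma hv_produces_p_Hardy_le:
  assumes "hv_produces TYPE('l) N l \<epsilon>\<^sub>A \<epsilon>\<^sub>B p" and "0 < l" "\<epsilon>\<^sub>A < 1" "\<epsilon>\<^sub>B < 1" and Z: "cond_Z N p"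
  shows "p_Hardy N p \<le> 1 - (1 - \<epsilon>\<^sub>A) * (1 - \<epsilon>\<^sub>B)"
proof -
  obtain M :: "'l measure" and q r where
    "hv_model M N q r" and md: "measurement_dependent M l q" and oi: "outcome_independent M N r"
    and pd: "parameter_dependent M N \<epsilon>\<^sub>A \<epsilon>\<^sub>B r"
    and p: "\<And>a b x y. a \<in> strings N \<Longrightarrow> b \<in> strings N \<Longrightarrow> p a b x y = hv_correlation M q r a b x y"
    using assms(1) unfolding hv_produces_def by blast
  interpret hv_model M N q r by fact
  have "cond_Z N (hv_correlation M q r)" using Z by (simp add: cond_Z_def p)
  from p_Hardy_hv_correlation_le[OF md \<open>0 < l\<close> oi pd \<open>\<epsilon>\<^sub>A < 1\<close> \<open>\<epsilon>\<^sub>B < 1\<close> this]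
  show ?thesis by (simp add: p_Hardy_iterated_sum p cong: if_cong)
qed


section \<open>Hidden variables in a fixed type\<close>

text \<open>
  The finitely many functions \<open>p(x,y|\<lambda>)\<close> and \<open>p(a,b|\<lambda>,x,y)\<close> are all that matters of the hidden
  variable, so \<open>\<mu>\<close> can be replaced by the distribution of the vector of their values. It is put on
  the range of that vector, where the conditions on the model hold everywhere and not only almost
  everywhere.
\<close>

type_synonym hv_index = "(2 \<times> 2) + (2 \<times> 2 \<times> 2 list \<times> 2 list)"

text \<open>The countable index type contains strings of every length, so one target type serves all
  \<open>N\<close>. The value 0 outside \<open>strings N\<close> keeps every coordinate measurable,
  since \<open>r\<close> is assumed measurable only on those strings.\<close>

definition hv_code ::
  "nat \<Rightarrow> ('l \<Rightarrow> 2 \<Rightarrow> 2 \<Rightarrow> real) \<Rightarrow> ('l \<Rightarrow> 2 \<Rightarrow> 2 \<Rightarrow> 2 list \<Rightarrow> 2 list \<Rightarrow> real) \<Rightarrow> 'l \<Rightarrow> nat \<Rightarrow> real" where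
  "hv_code N q r w n = (case from_nat n :: hv_index of
     Inl (x, y) \<Rightarrow> q w x y
   | Inr (x, y, a, b) \<Rightarrow> if a \<in> strings N \<and> b \<in> strings N then r w x y a b else 0)"

definition decode_q :: "(nat \<Rightarrow> real) \<Rightarrow> 2 \<Rightarrow> 2 \<Rightarrow> real" where
  "decode_q v x y = v (to_nat (Inl (x, y) :: hv_index))"

definition decode_r :: "(nat \<Rightarrow> real) \<Rightarrow> 2 \<Rightarrow> 2 \<Rightarrow> 2 list \<Rightarrow> 2 list \<Rightarrow> real" where
  "decode_r v x y a b = v (to_nat (Inr (x, y, a, b) :: hv_index))"

lemma decode_q_hv_code [simp]: "decode_q (hv_code N q r w) = q w"
  by (simp add: decode_q_def hv_code_def fun_eq_iff)

lemma decode_r_hv_code [simp]: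
  "a \<in> strings N \<Longrightarrow> b \<in> strings N \<Longrightarrow> decode_r (hv_code N q r w) x y a b = r w x y a b"
  by (simp add: decode_r_def hv_code_def)

lemma marginal_decode_r [simp]:
  "a \<in> strings N \<Longrightarrow> marginal_A N decode_r (hv_code N q r w) x y a = marginal_A N r w x y a"
  "b \<in> strings N \<Longrightarrow> marginal_B N decode_r (hv_code N q r w) x y b = marginal_B N r w x y b"
  by (simp_all add: marginal_A_def marginal_B_def)

lemma hv_produces_nat_real:
  assumes "hv_produces TYPE('l) N l \<epsilon>\<^sub>A \<epsilon>\<^sub>B p"
  shows "hv_produces TYPE(nat \<Rightarrow> real) N l \<epsilon>\<^sub>A \<epsilon>\<^sub>B p"
proof -
  obtain M :: "'l measure" and q r where
    "hv_model M N q r" and md: "measurement_dependent M l q" and oi: "outcome_independent M N r"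
    and pd: "parameter_dependent M N \<epsilon>\<^sub>A \<epsilon>\<^sub>B r"
    and p: "\<And>a b x y. a \<in> strings N \<Longrightarrow> b \<in> strings N \<Longrightarrow> p a b x y = hv_correlation M q r a b x y"
    using assms unfolding hv_produces_def by blast
  interpret hv_model M N q r by fact
  let ?f = "hv_code N q r"
  \<comment> \<open>The range of \<open>?f\<close> need not be measurable in the product space; the
    trace sigma-algebra on it suffices.\<close>
  define K where "K = restrict_space (\<Pi>\<^sub>M i\<in>(UNIV :: nat set). (borel :: real measure)) (?f ` space M)"
  define M' where "M' = distr M K ?f"
  have "(\<lambda>w. if a \<in> strings N \<and> b \<in> strings N then r w x y a b else 0) \<in> borel_measurable M"
    for x y a b
    by (cases "a \<in> strings N \<and> b \<in> strings N") (auto simp: r_measurable)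
  then have "(\<lambda>w. ?f w n) \<in> borel_measurable M" for n
    by (cases "from_nat n :: hv_index") (auto simp: hv_code_def q_measurable)
  then have "?f \<in> M \<rightarrow>\<^sub>M (\<Pi>\<^sub>M i\<in>UNIV. borel)"
    by (intro measurable_PiM_single') auto
  then have f: "?f \<in> M \<rightarrow>\<^sub>M K"
    unfolding K_def by (intro measurable_restrict_space2) auto
  have space: "space M' = ?f ` space M"
    by (auto simp: M'_def K_def space_restrict_space space_PiM)
  have component: "(\<lambda>v. v n) \<in> borel_measurable K" for n
    unfolding K_def by (rule measurable_restrict_space1) simp
  have meas_q: "(\<lambda>v. decode_q v x y) \<in> borel_measurable K" for x y
    unfolding decode_q_def by (rule component)
  have meas_r: "(\<lambda>v. decode_r v x y a b) \<in> borel_measurable K" for x y a b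
    unfolding decode_r_def by (rule component)
  interpret M': prob_space M'
    unfolding M'_def by (rule prob_space_distr) (rule f)
  have "hv_model M' N decode_q decode_r"
    by unfold_locales
      (auto simp: space q_nonneg q_sum r_nonneg r_sum cong: sum.cong,
       auto simp: M'_def meas_q meas_r)
  moreover have "measurement_dependent M' l decode_q"
    using md by (auto simp: measurement_dependent_def space)
  moreover have "outcome_independent M' N decode_r"
    using oi by (auto simp: outcome_independent_def space)
  moreover have "parameter_dependent M' N \<epsilon>\<^sub>A \<epsilon>\<^sub>B decode_r"
    using pd by (auto simp: parameter_dependent_def space)
  \<comment> \<open>Change of variables along \<open>?f\<close>, for the setting distribution and
    for the numerator.\<close>
  moreover have "p a b x y = hv_correlation M' decode_q decode_r a b x y"
    if "a \<in> strings N" "b \<in> strings N" for a b x y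
    using that f meas_q meas_r
    by (simp add: p hv_correlation_def hv_settings_def M'_def integral_distr)
  ultimately show ?thesis
    unfolding hv_produces_def by blast
qed

theorem mainTheorem3:
  shows "(\<forall>N\<ge>1. cond_Z N (p_quantum N)) \<and>
    (\<lambda>N. p_Hardy N (p_quantum N)) \<longlonglongrightarrow> 1 \<and>
    (\<forall>l > 0. \<forall>\<epsilon>\<^sub>A \<in> {0..<1}. \<forall>\<epsilon>\<^sub>B \<in> {0..<1}.
       \<exists>N\<ge>1. \<not> (\<exists>p. hv_produces TYPE(nat \<Rightarrow> real) N l \<epsilon>\<^sub>A \<epsilon>\<^sub>B p \<and>
         cond_Z N p \<and> p_Hardy N p = p_Hardy N (p_quantum N))) \<and>
    (\<forall>N\<ge>1. \<forall>l \<epsilon>\<^sub>A \<epsilon>\<^sub>B p. hv_produces TYPE('l) N l \<epsilon>\<^sub>A \<epsilon>\<^sub>B p \<longrightarrow>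
         hv_produces TYPE(nat \<Rightarrow> real) N l \<epsilon>\<^sub>A \<epsilon>\<^sub>B p)"
proof (intro conjI allI impI ballI)
  fix l \<epsilon>\<^sub>A \<epsilon>\<^sub>B :: real
  assume "0 < l" and \<epsilon>: "\<epsilon>\<^sub>A \<in> {0..<1}" "\<epsilon>\<^sub>B \<in> {0..<1}"
  then have "1 - (1 - \<epsilon>\<^sub>A) * (1 - \<epsilon>\<^sub>B) < 1" by simp
  \<comment> \<open>The bound for models is a constant below 1, so the quantum value eventually
    exceeds it and equality becomes impossible.\<close>
  from order_tendstoD(1)[OF p_Hardy_p_quantum_tendsto this]
  have "\<forall>\<^sub>F N in sequentially. 1 - (1 - \<epsilon>\<^sub>A) * (1 - \<epsilon>\<^sub>B) < p_Hardy N (p_quantum N)" .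
  with eventually_ge_at_top[of 1]
  have "\<forall>\<^sub>F N in sequentially. 1 \<le> N \<and> 1 - (1 - \<epsilon>\<^sub>A) * (1 - \<epsilon>\<^sub>B) < p_Hardy N (p_quantum N)"
    by eventually_elim simp
  then obtain N where "1 \<le> N" and N: "1 - (1 - \<epsilon>\<^sub>A) * (1 - \<epsilon>\<^sub>B) < p_Hardy N (p_quantum N)"
    by (auto dest: eventually_happens)
  have "\<not> (\<exists>p. hv_produces TYPE(nat \<Rightarrow> real) N l \<epsilon>\<^sub>A \<epsilon>\<^sub>B p \<and>
      cond_Z N p \<and> p_Hardy N p = p_Hardy N (p_quantum N))"
    using hv_produces_p_Hardy_le[where 'l = "nat \<Rightarrow> real"] \<open>0 < l\<close> \<epsilon> N by fastforce
  with \<open>1 \<le> N\<close>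
  show "\<exists>N\<ge>1. \<not> (\<exists>p. hv_produces TYPE(nat \<Rightarrow> real) N l \<epsilon>\<^sub>A \<epsilon>\<^sub>B p \<and>
      cond_Z N p \<and> p_Hardy N p = p_Hardy N (p_quantum N))" by blast
qed (auto intro: cond_Z_p_quantum p_Hardy_p_quantum_tendsto hv_produces_nat_real)

end
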